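(* Let $X$ be a Tychonoff space and let $E$ be any set of functions with $L(X)\subseteq E\subseteq C(X_{\aleph_0})$, endowed with the topology of pointwise convergence. Then $hl(E)=hd^*(X_{\aleph_0})$.
   Context: All spaces are Tychonoff. A zero-set of $X$ is a set $\{x\in X: f(x)=0\}$ with $f:X\to\mathbb{R}$ continuous; $Z(X)$ is the family of all zero-sets of $X$. $X_{\aleph_0}$ is the set $X$ with the (Baire) topology having $Z(X)$ as a base. $C(X_{\aleph_0})$ is the set of all continuous real-valued functions on $X_{\aleph_0}$. $L(X)=\{n_1 f_{Z_1}+\dots+n_k f_{Z_k}: k\in\mathbb{N},\ n_i\in\mathbb{N},\ Z_i\in Z(X)\}$, where $f_Z$ is the characteristic function of $Z\subseteq X$. The topology of pointwise convergence on $E$ is the subspace topology from $\mathbb{R}^X$. $hl(Y)=\sup\{l(Z): Z\subseteq Y\}$ is the hereditary Lindelöf number ($l$ = Lindelöf number), $hd(Y)=\sup\{d(Z): Z\subseteq Y\}$ is the hereditary density ($d$ = density), and $hd^*(Y)=\sup\{hd(Y^n): n\in\mathbb{N}\}$. As is standard, values of cardinal functions are taken to be infinite cardinals (at least $\omega_0$). *)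

theory Defs
  imports "HOL-Analysis.Analysis"
begin

unbundle cardinal_syntax
no_notation elt_set_eq (infix "=o" 50) (* clashes with the cardinal equality *)

text \<open>
  Cardinals are cardinal-order relations. A cardinal function of a space with points in
  \<open>'a\<close> takes values in \<open>(nat + 'a) rel\<close>, which contains a representative of
  every cardinal up to max of omega and the cardinality of the space. Minima and suprema are
  unique only up to \<open>=o\<close>, so that is the equality to be used between values.
\<close>

definition min_card :: "'c rel set \<Rightarrow> 'c rel" where
  "min_card K = (SOME \<kappa>. \<kappa> \<in> K \<and> (\<forall>\<mu>\<in>K. \<kappa> \<le>o \<mu>))"

definition sup_card :: "'c rel set \<Rightarrow> 'c rel" where
  "sup_card K = min_card {\<kappa>. Card_order \<kappa> \<and> (\<forall>\<mu>\<in>K. \<mu> \<le>o \<kappa>)}"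

lemma min_card:
  assumes "K \<noteq> {}" "\<forall>\<kappa>\<in>K. Card_order \<kappa>"
  shows "min_card K \<in> K \<and> (\<forall>\<mu>\<in>K. min_card K \<le>o \<mu>)"
proof -
  have "\<exists>\<kappa>. \<kappa> \<in> K \<and> (\<forall>\<mu>\<in>K. \<kappa> \<le>o \<mu>)"
    using exists_minim_Card_order[OF assms] by (simp only: Bex_def)
  from someI_ex[OF this] show ?thesis unfolding min_card_def .
qed

lemma sup_card:
  fixes K :: "'c rel set"
  assumes "\<forall>\<mu>\<in>K. Card_order \<mu>"
  shows "Card_order (sup_card K)"
    and "\<And>\<mu>. \<mu> \<in> K \<Longrightarrow> \<mu> \<le>o sup_card K"
    and "\<And>\<kappa>::'c rel. Card_order \<kappa> \<Longrightarrow> (\<And>\<mu>. \<mu> \<in> K \<Longrightarrow> \<mu> \<le>o \<kappa>) \<Longrightarrow> sup_card K \<le>o \<kappa>"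
proof -
  let ?B = "{\<kappa>::'c rel. Card_order \<kappa> \<and> (\<forall>\<mu>\<in>K. \<mu> \<le>o \<kappa>)}"
  have "\<mu> \<le>o |UNIV :: 'c set|" if "\<mu> \<in> K" for \<mu>
  proof -
    have "\<mu> =o |Field \<mu>|" using assms that by (simp add: card_of_Field_ordIso ordIso_symmetric)
    moreover have "|Field \<mu>| \<le>o |UNIV :: 'c set|" by (rule card_of_mono1) simp
    ultimately show ?thesis by (rule ordIso_ordLeq_trans)
  qed
  then have U: "|UNIV :: 'c set| \<in> ?B" by (simp add: card_of_Card_order)
  have ne: "?B \<noteq> {}" by (rule ex_in_conv[THEN iffD1]) (rule exI, rule U)
  have *: "sup_card K \<in> ?B \<and> (\<forall>\<kappa>\<in>?B. sup_card K \<le>o \<kappa>)"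
    unfolding sup_card_def by (rule min_card[OF ne]) simp
  show "Card_order (sup_card K)" using conjunct1[OF *] by simp
  show "\<mu> \<le>o sup_card K" if "\<mu> \<in> K" for \<mu>
    using conjunct1[OF *] that by simp
  show "sup_card K \<le>o \<kappa>" if "Card_order \<kappa>" "\<And>\<mu>. \<mu> \<in> K \<Longrightarrow> \<mu> \<le>o \<kappa>" for \<kappa> :: "'c rel"
    by (rule bspec[OF conjunct2[OF *]]) (use that in blast)
qed

definition lindelof_number :: "'a topology \<Rightarrow> (nat + 'a) rel" where
  "lindelof_number Y = min_card {\<kappa>. Card_order \<kappa> \<and> natLeq \<le>o \<kappa> \<and>
     (\<forall>\<U>. (\<forall>U\<in>\<U>. openin Y U) \<and> \<Union>\<U> = topspace Y \<longrightarrow>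
        (\<exists>\<V>. \<V> \<subseteq> \<U> \<and> |\<V>| \<le>o \<kappa> \<and> \<Union>\<V> = topspace Y))}"

text \<open>Adding \<open>natLeq\<close> makes the value infinite, and does not change an infinite cardinality.\<close>

definition density_number :: "'a topology \<Rightarrow> (nat + 'a) rel" where
  "density_number Y = min_card {natLeq +c |D| | D. D \<subseteq> topspace Y \<and> Y closure_of D = topspace Y}"

definition hl :: "'a topology \<Rightarrow> (nat + 'a) rel" where
  "hl Y = sup_card {lindelof_number (subtopology Y S) | S. S \<subseteq> topspace Y}"

definition hd_card :: "'a topology \<Rightarrow> (nat + 'a) rel" where
  "hd_card Y = sup_card {density_number (subtopology Y S) | S. S \<subseteq> topspace Y}"

definition power_topology :: "'a topology \<Rightarrow> nat \<Rightarrow> (nat \<Rightarrow> 'a) topology" where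
  "power_topology Y n = product_topology (\<lambda>_. Y) {..<n}"

definition hd_star :: "'a topology \<Rightarrow> (nat + (nat \<Rightarrow> 'a)) rel" where
  "hd_star Y = sup_card {hd_card (power_topology Y n) | n. 1 \<le> n}"

text \<open>The minimum defining the Lindelof number is attained within \<open>(nat + 'a) rel\<close>.\<close>

lemma lindelof_number_exists:
  fixes Y :: "'a topology"
  shows "|UNIV :: (nat + 'a) set| \<in> {\<kappa>. Card_order \<kappa> \<and> natLeq \<le>o \<kappa> \<and>
     (\<forall>\<U>. (\<forall>U\<in>\<U>. openin Y U) \<and> \<Union>\<U> = topspace Y \<longrightarrow>
        (\<exists>\<V>. \<V> \<subseteq> \<U> \<and> |\<V>| \<le>o \<kappa> \<and> \<Union>\<V> = topspace Y))}"
proof -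
  have "|UNIV :: nat set| \<le>o |UNIV :: (nat + 'a) set|"
    by (rule card_of_ordLeqI[of Inl]) auto
  then have 1: "natLeq \<le>o |UNIV :: (nat + 'a) set|"
    using card_of_nat ordIso_ordLeq_trans ordIso_symmetric by blast
  have 2: "\<exists>\<V>. \<V> \<subseteq> \<U> \<and> |\<V>| \<le>o |UNIV :: (nat + 'a) set| \<and> \<Union>\<V> = topspace Y"
    if "\<Union>\<U> = topspace Y" for \<U>
  proof -
    have "\<forall>x\<in>topspace Y. \<exists>U. x \<in> U \<and> U \<in> \<U>" using that by blast
    from bchoice[OF this]
    obtain f where f: "\<And>x. x \<in> topspace Y \<Longrightarrow> x \<in> f x \<and> f x \<in> \<U>" by blast
    have "|f ` topspace Y| \<le>o |topspace Y|" by (rule card_of_image)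
    moreover have "|topspace Y| \<le>o |UNIV :: (nat + 'a) set|"
      by (rule card_of_ordLeqI[of Inr]) auto
    ultimately have "|f ` topspace Y| \<le>o |UNIV :: (nat + 'a) set|" by (rule ordLeq_transitive)
    moreover have "f ` topspace Y \<subseteq> \<U>" "\<Union>(f ` topspace Y) = topspace Y"
      using f that by blast+
    ultimately show ?thesis by blast
  qed
  show ?thesis using 1 2 by (simp add: card_of_Card_order)
qed

definition zero_sets :: "'a topology \<Rightarrow> 'a set set" where
  "zero_sets X = {{x \<in> topspace X. f x = 0} | f. continuous_map X euclideanreal f}"

definition baire_topology :: "'a topology \<Rightarrow> 'a topology" where
  "baire_topology X = topology (arbitrary union_of (\<lambda>S. S \<in> zero_sets X))"

lemma openin_baire_topology:
  "openin (baire_topology X) = arbitrary union_of (\<lambda>S. S \<in> zero_sets X)"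
proof -
  have "S \<inter> T \<in> zero_sets X" if ST: "S \<in> zero_sets X" "T \<in> zero_sets X" for S T
  proof -
    obtain f g where f: "continuous_map X euclideanreal f" "S = {x \<in> topspace X. f x = 0}"
      and g: "continuous_map X euclideanreal g" "T = {x \<in> topspace X. g x = 0}"
      using ST unfolding zero_sets_def by blast
    have "continuous_map X euclideanreal (\<lambda>x. \<bar>f x\<bar> + \<bar>g x\<bar>)"
      using f g by (intro continuous_intros) auto
    moreover have "S \<inter> T = {x \<in> topspace X. \<bar>f x\<bar> + \<bar>g x\<bar> = 0}"
      using f g by auto
    ultimately show ?thesis
      unfolding zero_sets_def by (intro CollectI exI[of _ "\<lambda>x. \<bar>f x\<bar> + \<bar>g x\<bar>"] conjI)
  qed
  then show ?thesis
    unfolding baire_topology_def by (rule topology_inverse'[OF istopology_base])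
qed

lemma topspace_baire_topology [simp]: "topspace (baire_topology X) = topspace X"
proof
  show "topspace (baire_topology X) \<subseteq> topspace X"
    unfolding topspace_def[of "baire_topology X"] openin_baire_topology
    by (auto simp: union_of_def zero_sets_def)
  have "topspace X \<in> zero_sets X"
    unfolding zero_sets_def by (rule CollectI, rule exI[of _ "\<lambda>_. 0"]) auto
  then have "openin (baire_topology X) (topspace X)"
    by (simp add: openin_baire_topology arbitrary_union_of_inc)
  then show "topspace X \<subseteq> topspace (baire_topology X)"
    by (rule openin_subset)
qed

text \<open>
  A real function on \<open>topspace X\<close> is represented by its extensional extension, as in
  \<open>powertop_real (topspace X)\<close>, which serves as the product of real lines over the points.
\<close>

definition real_continuous_functions :: "'a topology \<Rightarrow> ('a \<Rightarrow> real) set" where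
  "real_continuous_functions Y = {f \<in> extensional (topspace Y). continuous_map Y euclideanreal f}"

definition L_functions :: "'a topology \<Rightarrow> ('a \<Rightarrow> real) set" where
  "L_functions X = {restrict (\<lambda>x. \<Sum>i<k. real (n i) * indicator (Z i) x) (topspace X) |
     (k::nat) (n::nat \<Rightarrow> nat) (Z::nat \<Rightarrow> 'a set). \<forall>i<k. Z i \<in> zero_sets X}"

definition pointwise_topology :: "'a topology \<Rightarrow> ('a \<Rightarrow> real) set \<Rightarrow> ('a \<Rightarrow> real) topology" where
  "pointwise_topology X E = subtopology (powertop_real (topspace X)) E"

definition tychonoff_space :: "'a topology \<Rightarrow> bool" where
  "tychonoff_space X \<longleftrightarrow> completely_regular_space X \<and> t1_space X"

end

theory Submission
  imports Defs
begin

text \<open>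
  Write \<open>Y\<close> for \<open>baire_topology X\<close>. Both inequalities come from reading the relation
  ``\<open>f\<close> maps the coordinates of \<open>x\<close> into prescribed open sets of reals'' in its two
  variables: fixing \<open>x\<close> gives a basic open set of functions, and fixing \<open>f\<close> gives
  an open set of points of \<open>Y\<^sup>n\<close>.

  For \<open>hl E \<le> hd\<^sup>* Y\<close>, a basic open set of functions is given by a finite tuple of points and a
  tuple \<open>V\<close> of sets from a countable base of the reals. For each of the countably many \<open>V\<close>,
  the tuples of points whose basic open set lies inside a member of the given open family form a
  subset of some \<open>Y\<^sup>n\<close>; by continuity of the functions in \<open>E\<close>, the basic open sets indexed by
  a dense part of this subset cover as much as all of them
  (\<open>hl_pointwise_topology_le\<close>).

  For \<open>hd\<^sup>* Y \<le> hl E\<close>, a box \<open>Z\<^sub>0 \<times> \<dots> \<times> Z\<^sub>n\<^sub>-\<^sub>1\<close> of zero-sets is coded by the single function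
  \<open>\<Sum>i<n. 2^i * indicator (Z\<^sub>i)\<close> of \<open>L_functions X\<close>, whose value at a point lists in binary the
  \<open>Z\<^sub>i\<close> containing it. Hence the functions that have, for every \<open>i\<close>, bit \<open>i\<close> set at \<open>x\<^sub>i\<close> form
  an open set \<open>W x\<close> which contains the code of a box exactly when the box contains \<open>x\<close>. If
  a subset \<open>D\<close> of \<open>A\<close> is such that the \<open>W x\<close> with \<open>x \<in> D\<close> cover all \<open>W x\<close> with
  \<open>x \<in> A\<close>, then every box meeting \<open>A\<close> meets \<open>D\<close>, so \<open>D\<close> is dense in \<open>A\<close>
  (\<open>hd_power_baire_le\<close>). Binary coding needs no disjointness of the \<open>Z\<^sub>i\<close>, so
  tuples with repeated coordinates are covered by the same argument.

  The two cardinal functions take values in different types. The lemmas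
  \<open>hl_le_iff\<close> and \<open>hd_card_le_iff\<close> therefore compare them with an infinite
  cardinal \<open>\<tau>\<close> over an arbitrary type.
\<close>

section \<open>Suprema and minima of cardinals across types\<close>

text \<open>A cardinal too large to be represented over a type \<open>'d\<close> bounds all cardinals of that type, so
  the trivial bound \<open>|UNIV|\<close> can replace it. Hence a supremum or minimum formed over \<open>'d\<close> can be
  compared with a cardinal of any other type.\<close>

lemma card_order_over_type:
  fixes \<tau> :: "'c rel"
  assumes "Card_order \<tau>"
  obtains \<kappa> :: "'d rel"
  where "Card_order \<kappa>" "\<kappa> \<le>o \<tau>" "\<kappa> =o \<tau> \<or> \<kappa> = |UNIV|"
proof (cases "|UNIV :: 'd set| \<le>o \<tau>")
  case True
  then show ?thesis using that[of "|UNIV|"] by (simp add: card_of_Card_order)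
next
  case False
  then have "\<tau> \<le>o |UNIV :: 'd set|"
    using assms ordLeq_total card_of_Well_order card_order_on_well_order_on by blast
  moreover have "|Field \<tau>| =o \<tau>" by (rule card_of_Field_ordIso[OF assms])
  ultimately have "|Field \<tau>| \<le>o |UNIV :: 'd set|" using ordIso_ordLeq_trans by blast
  then obtain B :: "'d set" where "|Field \<tau>| =o |B|"
    using internalize_card_of_ordLeq2[THEN iffD1] by blast
  then have "|B| =o \<tau>"
    using \<open>|Field \<tau>| =o \<tau>\<close> ordIso_symmetric ordIso_transitive by blast
  then show ?thesis
    using that[of "|B|"] card_of_Card_order ordIso_imp_ordLeq by blast
qed

lemma card_order_le_UNIV:
  fixes \<mu> :: "'d rel"
  assumes "Card_order \<mu>"
  shows "\<mu> \<le>o |UNIV :: 'd set|"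
  by (rule ordIso_ordLeq_trans[OF ordIso_symmetric[OF card_of_Field_ordIso[OF assms]]])
    (rule card_of_mono1[OF subset_UNIV])

lemma sup_card_le:
  fixes K :: "'d rel set" and \<tau> :: "'c rel"
  assumes "\<forall>\<mu>\<in>K. Card_order \<mu>" "Card_order \<tau>" "\<And>\<mu>. \<mu> \<in> K \<Longrightarrow> \<mu> \<le>o \<tau>"
  shows "sup_card K \<le>o \<tau>"
proof -
  obtain \<kappa> :: "'d rel" where \<kappa>: "Card_order \<kappa>" "\<kappa> \<le>o \<tau>" "\<kappa> =o \<tau> \<or> \<kappa> = |UNIV|"
    using card_order_over_type[OF assms(2)] .
  have "\<mu> \<le>o \<kappa>" if "\<mu> \<in> K" for \<mu>
    using \<kappa>(3) assms(1,3) that card_order_le_UNIV ordLeq_ordIso_trans ordIso_symmetric by blast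
  from sup_card(3)[OF assms(1) \<kappa>(1) this] show ?thesis
    using \<kappa>(2) ordLeq_transitive by blast
qed

lemma sup_card_le_iff:
  assumes "\<forall>\<mu>\<in>K. Card_order \<mu>" "Card_order \<tau>"
  shows "sup_card K \<le>o \<tau> \<longleftrightarrow> (\<forall>\<mu>\<in>K. \<mu> \<le>o \<tau>)"
proof
  assume "sup_card K \<le>o \<tau>"
  then show "\<forall>\<mu>\<in>K. \<mu> \<le>o \<tau>"
    using ordLeq_transitive[OF sup_card(2)[OF assms(1)]] by blast
next
  assume "\<forall>\<mu>\<in>K. \<mu> \<le>o \<tau>"
  then show "sup_card K \<le>o \<tau>" by (intro sup_card_le[OF assms]) (rule bspec)
qed

section \<open>Bounds on the Lindelof number and the density\<close>

lemma lindelof_number_works: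
  shows "Card_order (lindelof_number Y)"
    and "natLeq \<le>o lindelof_number Y"
    and "\<lbrakk>\<forall>U\<in>\<U>. openin Y U; \<Union>\<U> = topspace Y\<rbrakk>
      \<Longrightarrow> \<exists>\<V>. \<V> \<subseteq> \<U> \<and> |\<V>| \<le>o lindelof_number Y \<and> \<Union>\<V> = topspace Y"
proof -
  let ?K = "{\<kappa>::(nat + 'a) rel. Card_order \<kappa> \<and> natLeq \<le>o \<kappa> \<and>
     (\<forall>\<U>. (\<forall>U\<in>\<U>. openin Y U) \<and> \<Union>\<U> = topspace Y \<longrightarrow>
        (\<exists>\<V>. \<V> \<subseteq> \<U> \<and> |\<V>| \<le>o \<kappa> \<and> \<Union>\<V> = topspace Y))}"
  have "?K \<noteq> {}" using lindelof_number_exists[of Y] by blast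
  then have *: "lindelof_number Y \<in> ?K"
    unfolding lindelof_number_def using min_card[of ?K] by blast
  show "Card_order (lindelof_number Y)" "natLeq \<le>o lindelof_number Y"
    using * by blast+
  show "\<exists>\<V>. \<V> \<subseteq> \<U> \<and> |\<V>| \<le>o lindelof_number Y \<and> \<Union>\<V> = topspace Y"
    if "\<forall>U\<in>\<U>. openin Y U" "\<Union>\<U> = topspace Y"
    using * that by blast
qed

text \<open>If \<open>\<tau>\<close> has no representative over \<open>nat + 'a\<close>, its substitute \<open>|UNIV|\<close> is admissible in the
  minimum because every cover has a subcover with at most one member per point.\<close>

lemma lindelof_number_le:
  fixes Y :: "'a topology" and \<tau> :: "'c rel"
  assumes "Card_order \<tau>" "natLeq \<le>o \<tau>"
    and cov: "\<And>\<U>. \<lbrakk>\<forall>U\<in>\<U>. openin Y U; \<Union>\<U> = topspace Y\<rbrakk>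
      \<Longrightarrow> \<exists>\<V>. \<V> \<subseteq> \<U> \<and> |\<V>| \<le>o \<tau> \<and> \<Union>\<V> = topspace Y"
  shows "lindelof_number Y \<le>o \<tau>"
proof -
  let ?K = "{\<kappa>::(nat + 'a) rel. Card_order \<kappa> \<and> natLeq \<le>o \<kappa> \<and>
     (\<forall>\<U>. (\<forall>U\<in>\<U>. openin Y U) \<and> \<Union>\<U> = topspace Y \<longrightarrow>
        (\<exists>\<V>. \<V> \<subseteq> \<U> \<and> |\<V>| \<le>o \<kappa> \<and> \<Union>\<V> = topspace Y))}"
  obtain \<kappa> :: "(nat + 'a) rel"
    where \<kappa>: "Card_order \<kappa>" "\<kappa> \<le>o \<tau>" "\<kappa> =o \<tau> \<or> \<kappa> = |UNIV|"
    using card_order_over_type[OF assms(1)] .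
  have "\<kappa> \<in> ?K"
    using \<kappa>(3)
  proof
    assume eq: "\<kappa> =o \<tau>"
    then have "natLeq \<le>o \<kappa>"
      using assms(2) ordLeq_ordIso_trans ordIso_symmetric by blast
    moreover have "|\<V>| \<le>o \<kappa>" if "|\<V>| \<le>o \<tau>" for \<V> :: "'a set set"
      using that eq ordLeq_ordIso_trans ordIso_symmetric by blast
    ultimately show ?thesis
      using \<kappa>(1) cov by (simp only: mem_Collect_eq) meson
  next
    assume "\<kappa> = |UNIV|"
    then show ?thesis using lindelof_number_exists[of Y] by simp
  qed
  then have "lindelof_number Y \<le>o \<kappa>"
    unfolding lindelof_number_def using min_card[of ?K] by blast
  then show ?thesis using \<kappa>(2) by (rule ordLeq_transitive)
qed

lemma density_number_works:
  obtains D where "D \<subseteq> topspace Y" "Y closure_of D = topspace Y"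
    "density_number Y = natLeq +c |D|"
proof -
  let ?K = "{natLeq +c |D| | D. D \<subseteq> topspace Y \<and> Y closure_of D = topspace Y}"
  have "natLeq +c |topspace Y| \<in> ?K" by auto
  then have "density_number Y \<in> ?K"
    unfolding density_number_def using min_card[of ?K] Card_order_csum by blast
  then show ?thesis using that by blast
qed

lemma density_number_le:
  assumes "Card_order \<tau>" "natLeq \<le>o \<tau>" "D \<subseteq> topspace Y" "Y closure_of D = topspace Y" "|D| \<le>o \<tau>"
  shows "density_number Y \<le>o \<tau>"
proof -
  let ?K = "{natLeq +c |D| | D. D \<subseteq> topspace Y \<and> Y closure_of D = topspace Y}"
  have "natLeq +c |D| \<in> ?K" using assms by blast
  then have "density_number Y \<le>o natLeq +c |D|"
    unfolding density_number_def using min_card[of ?K] Card_order_csum by blast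
  moreover have "natLeq +c |D| \<le>o \<tau>"
    using assms cinfinite_mono[OF assms(2)] natLeq_cinfinite
    by (intro csum_cinfinite_bound) (auto simp: natLeq_Card_order card_of_Card_order)
  ultimately show ?thesis using ordLeq_transitive by blast
qed

lemma density_number_infinite: "natLeq \<le>o density_number Y" "Card_order (density_number Y)"
proof -
  obtain D where "density_number Y = natLeq +c |D|" using density_number_works .
  then show "natLeq \<le>o density_number Y" "Card_order (density_number Y)"
    by (simp_all only: ordLeq_csum1[OF natLeq_Card_order] Card_order_csum)
qed

section \<open>Bounds on the hereditary cardinal functions\<close>

lemma hl_infinite: "Card_order (hl Y)" "natLeq \<le>o hl Y"
proof -
  let ?K = "{lindelof_number (subtopology Y S) | S. S \<subseteq> topspace Y}"
  have K: "\<forall>\<mu>\<in>?K. Card_order \<mu>" using lindelof_number_works(1) by blast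
  show "Card_order (hl Y)" unfolding hl_def by (rule sup_card(1)[OF K])
  have "lindelof_number (subtopology Y {}) \<in> ?K" by blast
  from sup_card(2)[OF K this] show "natLeq \<le>o hl Y"
    unfolding hl_def using lindelof_number_works(2) ordLeq_transitive by blast
qed

lemma hd_card_infinite: "Card_order (hd_card Y)" "natLeq \<le>o hd_card Y"
proof -
  let ?K = "{density_number (subtopology Y S) | S. S \<subseteq> topspace Y}"
  have K: "\<forall>\<mu>\<in>?K. Card_order \<mu>" using density_number_infinite(2) by blast
  show "Card_order (hd_card Y)" unfolding hd_card_def by (rule sup_card(1)[OF K])
  have "density_number (subtopology Y {}) \<in> ?K" by blast
  from sup_card(2)[OF K this] show "natLeq \<le>o hd_card Y"
    unfolding hd_card_def using density_number_infinite(1) ordLeq_transitive by blast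
qed

lemma hd_star_infinite: "Card_order (hd_star Y)" "natLeq \<le>o hd_star Y"
proof -
  let ?K = "{hd_card (power_topology Y n) | n. 1 \<le> n}"
  have K: "\<forall>\<mu>\<in>?K. Card_order \<mu>" using hd_card_infinite(1) by blast
  show "Card_order (hd_star Y)" unfolding hd_star_def by (rule sup_card(1)[OF K])
  have "hd_card (power_topology Y 1) \<in> ?K" by blast
  from sup_card(2)[OF K this] show "natLeq \<le>o hd_star Y"
    unfolding hd_star_def using hd_card_infinite(2) ordLeq_transitive by blast
qed

lemma hd_star_le_iff:
  assumes "Card_order \<tau>"
  shows "hd_star Y \<le>o \<tau> \<longleftrightarrow> (\<forall>n\<ge>1. hd_card (power_topology Y n) \<le>o \<tau>)"
proof -
  have "\<forall>\<mu>\<in>{hd_card (power_topology Y n) | n. 1 \<le> n}. Card_order \<mu>"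
    using hd_card_infinite(1) by blast
  from sup_card_le_iff[OF this assms] show ?thesis unfolding hd_star_def by blast
qed

text \<open>The subspaces disappear: covering the subspace \<open>\<Union>\<U>\<close> by the open family \<open>\<U>\<close> is all that
  the hereditary Lindelof property is about.\<close>

lemma hl_le_iff:
  fixes Y :: "'a topology" and \<tau> :: "'c rel"
  assumes \<tau>: "Card_order \<tau>" "natLeq \<le>o \<tau>"
  shows "hl Y \<le>o \<tau> \<longleftrightarrow>
    (\<forall>\<U>. (\<forall>U\<in>\<U>. openin Y U) \<longrightarrow> (\<exists>\<V>. \<V> \<subseteq> \<U> \<and> |\<V>| \<le>o \<tau> \<and> \<Union>\<V> = \<Union>\<U>))"
    (is "_ \<longleftrightarrow> ?R")
proof -
  have "\<forall>\<mu>\<in>{lindelof_number (subtopology Y S) | S. S \<subseteq> topspace Y}. Card_order \<mu>"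
    using lindelof_number_works(1) by blast
  from sup_card_le_iff[OF this \<tau>(1)]
  have "hl Y \<le>o \<tau> \<longleftrightarrow> (\<forall>S\<subseteq>topspace Y. lindelof_number (subtopology Y S) \<le>o \<tau>)"
    unfolding hl_def by blast
  also have "\<dots> \<longleftrightarrow> ?R"
  proof (intro iffI allI impI)
    fix \<U> assume L: "\<forall>S\<subseteq>topspace Y. lindelof_number (subtopology Y S) \<le>o \<tau>"
      and \<U>: "\<forall>U\<in>\<U>. openin Y U"
    have sub: "\<Union>\<U> \<subseteq> topspace Y" using \<U> openin_subset by blast
    then have ts: "topspace (subtopology Y (\<Union>\<U>)) = \<Union>\<U>" by (simp add: inf.absorb2)
    have "\<forall>U\<in>\<U>. openin (subtopology Y (\<Union>\<U>)) U"
      using \<U> by (auto simp: openin_subtopology)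
    from lindelof_number_works(3)[OF this ts[symmetric]]
    obtain \<V> where \<V>: "\<V> \<subseteq> \<U>" "|\<V>| \<le>o lindelof_number (subtopology Y (\<Union>\<U>))" "\<Union>\<V> = \<Union>\<U>"
      unfolding ts by (elim exE conjE)
    have "lindelof_number (subtopology Y (\<Union>\<U>)) \<le>o \<tau>" using L sub by blast
    from \<V>(1) ordLeq_transitive[OF \<V>(2) this] \<V>(3)
    show "\<exists>\<V>. \<V> \<subseteq> \<U> \<and> |\<V>| \<le>o \<tau> \<and> \<Union>\<V> = \<Union>\<U>"
      by (intro exI conjI)
  next
    fix S assume R: ?R and S: "S \<subseteq> topspace Y"
    show "lindelof_number (subtopology Y S) \<le>o \<tau>"
    proof (rule lindelof_number_le[OF \<tau>])
      fix \<U> assume \<U>: "\<forall>U\<in>\<U>. openin (subtopology Y S) U" "\<Union>\<U> = topspace (subtopology Y S)"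
      then have "\<forall>U\<in>\<U>. \<exists>T. openin Y T \<and> U = T \<inter> S" by (simp add: openin_subtopology)
      then obtain T where T: "\<And>U. U \<in> \<U> \<Longrightarrow> openin Y (T U) \<and> U = T U \<inter> S"
        by metis
      then have "\<forall>U\<in>T ` \<U>. openin Y U" by blast
      then obtain \<W> where \<W>: "\<W> \<subseteq> T ` \<U>" "|\<W>| \<le>o \<tau>" "\<Union>\<W> = \<Union>(T ` \<U>)"
        using R[rule_format, of "T ` \<U>"] by metis
      let ?V = "(\<lambda>W. W \<inter> S) ` \<W>"
      have "\<Union>?V = \<Union>\<W> \<inter> S" by blast
      also have "\<dots> = (\<Union>U\<in>\<U>. T U \<inter> S)" unfolding \<W>(3) by blast
      also have "\<dots> = \<Union>\<U>" using T by simp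
      finally have cov: "\<Union>?V = topspace (subtopology Y S)" using \<U>(2) by simp
      have sub: "?V \<subseteq> \<U>"
      proof
        fix V assume "V \<in> ?V"
        then obtain U where "U \<in> \<U>" "V = T U \<inter> S" using \<W>(1) by blast
        then show "V \<in> \<U>" using T by metis
      qed
      from sub ordLeq_transitive[OF card_of_image \<W>(2)] cov
      show "\<exists>\<V>. \<V> \<subseteq> \<U> \<and> |\<V>| \<le>o \<tau> \<and> \<Union>\<V> = topspace (subtopology Y S)"
        by (intro exI conjI)
    qed
  qed
  finally show ?thesis .
qed

lemma hd_card_le_iff:
  fixes Y :: "'a topology" and \<tau> :: "'c rel"
  assumes \<tau>: "Card_order \<tau>" "natLeq \<le>o \<tau>"
  shows "hd_card Y \<le>o \<tau> \<longleftrightarrow>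
    (\<forall>A\<subseteq>topspace Y. \<exists>D\<subseteq>A. |D| \<le>o \<tau> \<and> A \<subseteq> Y closure_of D)"
    (is "_ \<longleftrightarrow> ?R")
proof -
  have "\<forall>\<mu>\<in>{density_number (subtopology Y S) | S. S \<subseteq> topspace Y}. Card_order \<mu>"
    using density_number_infinite(2) by blast
  from sup_card_le_iff[OF this \<tau>(1)]
  have "hd_card Y \<le>o \<tau> \<longleftrightarrow> (\<forall>A\<subseteq>topspace Y. density_number (subtopology Y A) \<le>o \<tau>)"
    unfolding hd_card_def by blast
  also have "\<dots> \<longleftrightarrow> ?R"
  proof (rule all_cong)
    fix A assume A: "A \<subseteq> topspace Y"
    show "density_number (subtopology Y A) \<le>o \<tau> \<longleftrightarrow>
      (\<exists>D\<subseteq>A. |D| \<le>o \<tau> \<and> A \<subseteq> Y closure_of D)"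
    proof
      assume d: "density_number (subtopology Y A) \<le>o \<tau>"
      obtain D where D: "D \<subseteq> topspace (subtopology Y A)"
        "subtopology Y A closure_of D = topspace (subtopology Y A)"
        "density_number (subtopology Y A) = natLeq +c |D|"
        using density_number_works .
      have "|D| \<le>o \<tau>"
        using ordLeq_transitive[OF ordLeq_csum2[OF card_of_Card_order]] d[unfolded D(3)] .
      moreover have "A \<subseteq> Y closure_of D" "D \<subseteq> A"
        using D(1,2) A by (auto simp: closure_of_subtopology inf.absorb2)
      ultimately show "\<exists>D\<subseteq>A. |D| \<le>o \<tau> \<and> A \<subseteq> Y closure_of D" by (intro exI conjI)
    next
      assume "\<exists>D\<subseteq>A. |D| \<le>o \<tau> \<and> A \<subseteq> Y closure_of D"
      then obtain D where D: "D \<subseteq> A" "|D| \<le>o \<tau>" "A \<subseteq> Y closure_of D" by blast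
      show "density_number (subtopology Y A) \<le>o \<tau>"
        by (rule density_number_le[OF \<tau>, where D = D])
          (use A D in \<open>auto simp: closure_of_subtopology inf.absorb2\<close>)
    qed
  qed
  finally show ?thesis .
qed

section \<open>Hereditary density of powers bounds the hereditary Lindelof number\<close>

text \<open>The countable union, over the lists \<open>V\<close> of base sets, of the dense sets of points \<open>x\<close> still has
  cardinality at most \<open>\<tau>\<close>, because \<open>\<tau>\<close> is infinite; it indexes the required subfamily.\<close>

lemma hl_pointwise_topology_le:
  fixes X Y :: "'a topology" and \<tau> :: "'c rel"
  assumes ts: "topspace Y = topspace X"
    and E: "E \<subseteq> real_continuous_functions Y"
    and \<tau>: "Card_order \<tau>" "natLeq \<le>o \<tau>"
    and hd: "\<And>n. 1 \<le> n \<Longrightarrow> hd_card (power_topology Y n) \<le>o \<tau>"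
  shows "hl (pointwise_topology X E) \<le>o \<tau>"
  unfolding hl_le_iff[OF \<tau>]
proof (intro allI impI)
  fix \<U> assume \<U>: "\<forall>U\<in>\<U>. openin (pointwise_topology X E) U"
  obtain \<B> :: "real set set" where \<B>: "countable \<B>" "topological_basis \<B>"
    using ex_countable_basis by blast
  define W where "W V x = {g \<in> E. \<forall>i<length V. g (x i) \<in> V ! i}"
    for V :: "real set list" and x :: "nat \<Rightarrow> 'a"
  define A where "A V = {x \<in> topspace (power_topology Y (length V)). \<exists>U\<in>\<U>. W V x \<subseteq> U}" for V
  \<comment> \<open>a basic neighbourhood restricts finitely many coordinates; listing them gives the tuple \<open>x\<close>\<close>
  have basic: "\<exists>V\<in>lists \<B>. \<exists>x\<in>A V. f \<in> W V x" if "U \<in> \<U>" "f \<in> U" for f U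
  proof -
    obtain T where T: "openin (powertop_real (topspace X)) T" "U = T \<inter> E"
      using \<U> \<open>U \<in> \<U>\<close> unfolding pointwise_topology_def openin_subtopology by blast
    have "f \<in> T" "f \<in> E" using T \<open>f \<in> U\<close> by auto
    then obtain O' where O': "finite {i \<in> topspace X. O' i \<noteq> UNIV}"
      "\<And>i. i \<in> topspace X \<Longrightarrow> open (O' i)" "f \<in> PiE (topspace X) O'" "PiE (topspace X) O' \<subseteq> T"
      using T(1) unfolding openin_product_topology_alt by (auto simp del: PiE_iff)
    obtain xs where xs: "set xs = {i \<in> topspace X. O' i \<noteq> UNIV}"
      using finite_list[OF O'(1)] by blast
    have "\<exists>B\<in>\<B>. f a \<in> B \<and> B \<subseteq> O' a" if "a \<in> set xs" for a
    proof -
      have "open (O' a)" "f a \<in> O' a" using that xs O' by auto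
      from topological_basisE[OF \<B>(2) this] show ?thesis by blast
    qed
    then obtain B where B: "\<And>a. a \<in> set xs \<Longrightarrow> B a \<in> \<B> \<and> f a \<in> B a \<and> B a \<subseteq> O' a"
      by metis
    let ?V = "map B xs" and ?x = "\<lambda>i\<in>{..<length xs}. xs ! i"
    have "?V \<in> lists \<B>" using B by auto
    moreover have "f \<in> W ?V ?x" unfolding W_def using B \<open>f \<in> E\<close> by auto
    moreover have "W ?V ?x \<subseteq> U"
    proof
      fix g assume g: "g \<in> W ?V ?x"
      then have "g \<in> E" unfolding W_def by blast
      then have "g \<in> extensional (topspace X)"
        using E ts unfolding real_continuous_functions_def by auto
      moreover have "g a \<in> O' a" if a: "a \<in> topspace X" for a
      proof (cases "a \<in> set xs")
        case True
        then obtain i where "i < length xs" "xs ! i = a" by (auto simp: in_set_conv_nth)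
        then have "g a \<in> B a" using g unfolding W_def by auto
        then show ?thesis using B[OF True] by blast
      next
        case False
        then show ?thesis using a xs by auto
      qed
      ultimately have "g \<in> PiE (topspace X) O'" by (simp add: PiE_iff)
      then have "g \<in> T" using O'(4) by (rule subsetD[rotated])
      then show "g \<in> U" using T(2) \<open>g \<in> E\<close> by blast
    qed
    moreover have "?x \<in> topspace (power_topology Y (length ?V))"
      using xs ts nth_mem[of _ xs] unfolding power_topology_def
      by (auto simp del: nth_mem)
    ultimately show ?thesis unfolding A_def using \<open>U \<in> \<U>\<close> by blast
  qed
  have "\<exists>D\<subseteq>A V. |D| \<le>o \<tau> \<and> A V \<subseteq> power_topology Y (length V) closure_of D" for V
  proof (cases "length V = 0")
    case True
    \<comment> \<open>the bound on powers starts at exponent 1, but the zeroth power is a single point\<close>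
    have "A V \<subseteq> {\<lambda>_. undefined}" using True unfolding A_def power_topology_def by auto
    then have "finite (A V)" using finite_subset by blast
    then have "|A V| <o natLeq" by (simp only: finite_iff_ordLess_natLeq)
    then have small: "|A V| \<le>o \<tau>" by (rule ordLeq_transitive[OF ordLess_imp_ordLeq \<tau>(2)])
    have "A V \<subseteq> power_topology Y (length V) closure_of A V"
      by (rule closure_of_subset) (auto simp: A_def)
    with order_refl small show ?thesis by (intro exI conjI)
  next
    case False
    have AV: "A V \<subseteq> topspace (power_topology Y (length V))" unfolding A_def by blast
    have "hd_card (power_topology Y (length V)) \<le>o \<tau>" using False by (intro hd) linarith
    from this[unfolded hd_card_le_iff[OF \<tau>], THEN spec, THEN mp, OF AV] show ?thesis .
  qed
  then obtain D where D: "\<And>V. D V \<subseteq> A V" "\<And>V. |D V| \<le>o \<tau>"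
    "\<And>V. A V \<subseteq> power_topology Y (length V) closure_of D V"
    by metis
  \<comment> \<open>moving \<open>x\<close> to a nearby point of \<open>D V\<close> keeps \<open>f \<in> W V x\<close>, because \<open>f\<close> is continuous\<close>
  have dense: "\<exists>y\<in>D V. f \<in> W V y" if "x \<in> A V" "f \<in> W V x" "V \<in> lists \<B>" for f V x
  proof -
    have f: "f \<in> E" "continuous_map Y euclideanreal f"
      using that(2) E unfolding W_def real_continuous_functions_def by auto
    let ?N = "PiE {..<length V} (\<lambda>i. {z \<in> topspace Y. f z \<in> V ! i})"
    have "openin Y {z \<in> topspace Y. f z \<in> V ! i}" if "i < length V" for i
    proof (rule openin_continuous_map_preimage[OF f(2)])
      have "V ! i \<in> \<B>" using that \<open>V \<in> lists \<B>\<close> by auto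
      then show "openin euclideanreal (V ! i)" using topological_basis_open[OF \<B>(2)] by simp
    qed
    then have "openin (power_topology Y (length V)) ?N"
      unfolding power_topology_def openin_PiE_gen by auto
    moreover have "x \<in> ?N"
      using that(1,2) unfolding A_def W_def power_topology_def by (auto simp: PiE_iff)
    moreover have "x \<in> power_topology Y (length V) closure_of D V" using D(3) that(1) by blast
    ultimately obtain y where "y \<in> D V" "y \<in> ?N" unfolding in_closure_of by blast
    then show ?thesis using f(1) unfolding W_def by (auto simp: PiE_iff)
  qed
  define u where "u V x = (SOME U. U \<in> \<U> \<and> W V x \<subseteq> U)" for V x
  have u: "u V x \<in> \<U> \<and> W V x \<subseteq> u V x" if "x \<in> A V" for V x
    unfolding u_def by (rule someI_ex) (use that in \<open>auto simp: A_def\<close>)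
  let ?S = "\<Union>V\<in>lists \<B>. u V ` D V"
  have sub: "?S \<subseteq> \<U>" using u D(1) by blast
  moreover have "|?S| \<le>o \<tau>"
  proof (rule card_of_UNION_ordLeq_infinite_Field)
    show "infinite (Field \<tau>)"
      using cinfinite_mono[OF \<tau>(2) natLeq_cinfinite] unfolding cinfinite_def .
    have "countable (lists \<B>)" using \<B>(1) by simp
    then have "|lists \<B>| \<le>o |UNIV :: nat set|" by (intro card_of_ordLeqI[OF inj_on_to_nat_on]) auto
    then have "|lists \<B>| \<le>o natLeq" using card_of_nat by (rule ordLeq_ordIso_trans)
    then show "|lists \<B>| \<le>o \<tau>" using \<tau>(2) by (rule ordLeq_transitive)
    show "\<forall>V\<in>lists \<B>. |u V ` D V| \<le>o \<tau>"
      using ordLeq_transitive[OF card_of_image D(2)] by blast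
  qed (rule \<tau>(1))
  moreover have "\<Union>?S = \<Union>\<U>"
  proof
    show "\<Union>\<U> \<subseteq> \<Union>?S"
    proof
      fix f assume "f \<in> \<Union>\<U>"
      then obtain V x where V: "V \<in> lists \<B>" "x \<in> A V" "f \<in> W V x" using basic by blast
      then obtain y where y: "y \<in> D V" "f \<in> W V y" using dense by blast
      then have "f \<in> u V y" using u D(1) by blast
      then show "f \<in> \<Union>?S" using V(1) y(1) by blast
    qed
  qed (use sub in blast)
  ultimately show "\<exists>\<V>. \<V> \<subseteq> \<U> \<and> |\<V>| \<le>o \<tau> \<and> \<Union>\<V> = \<Union>\<U>" by (intro exI conjI)
qed

section \<open>The hereditary Lindelof number bounds the hereditary density of powers\<close>

lemma zero_box_neighbourhood:
  assumes "openin (power_topology (baire_topology X) n) U" "x \<in> U"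
  obtains Z where "\<And>i. i < n \<Longrightarrow> Z i \<in> zero_sets X" "x \<in> PiE {..<n} Z" "PiE {..<n} Z \<subseteq> U"
proof -
  obtain O' where O': "\<And>i. i < n \<Longrightarrow> openin (baire_topology X) (O' i)"
    "x \<in> PiE {..<n} O'" "PiE {..<n} O' \<subseteq> U"
    using bspec[OF assms(1)[unfolded power_topology_def openin_product_topology_alt] assms(2)]
    by (metis lessThan_iff)
  have "\<exists>Z. Z \<in> zero_sets X \<and> x i \<in> Z \<and> Z \<subseteq> O' i" if "i < n" for i
  proof -
    have "x i \<in> O' i" using O'(2) that by auto
    then show ?thesis
      using O'(1)[OF that] unfolding openin_baire_topology arbitrary_union_of_alt by blast
  qed
  then obtain Z where Z: "\<And>i. i < n \<Longrightarrow> Z i \<in> zero_sets X \<and> x i \<in> Z i \<and> Z i \<subseteq> O' i"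
    by metis
  show ?thesis
  proof (rule that[of Z])
    show "x \<in> PiE {..<n} Z" using Z O'(2) by (auto simp: PiE_iff)
    have "PiE {..<n} Z \<subseteq> PiE {..<n} O'" using Z by (intro PiE_mono) auto
    then show "PiE {..<n} Z \<subseteq> U" using O'(3) by (rule subset_trans)
  qed (use Z in blast)
qed

text \<open>The open balls of radius 1/2 around integers are disjoint, so this open set meets the
  naturals exactly in the numbers whose bit \<open>i\<close> is set.\<close>

definition bit_region :: "nat \<Rightarrow> real set" where
  "bit_region i = (\<Union>m\<in>{m::nat. bit m i}. ball (real m) (1/2))"

lemma open_bit_region: "open (bit_region i)"
  unfolding bit_region_def by blast

lemma real_in_bit_region_iff: "real k \<in> bit_region i \<longleftrightarrow> bit k i"
proof
  assume "real k \<in> bit_region i"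
  then obtain m where "bit m i" "\<bar>real m - real k\<bar> < 1/2"
    unfolding bit_region_def by (auto simp: dist_real_def)
  moreover from this(2) have "m = k" by linarith
  ultimately show "bit k i" by simp
next
  assume "bit k i"
  then show "real k \<in> bit_region i" unfolding bit_region_def by force
qed

text \<open>Distinct powers of two make the set of indices \<open>i\<close> with \<open>x \<in> Z i\<close> recoverable from the value
  at \<open>x\<close>, whether or not the \<open>Z i\<close> overlap.\<close>

definition box_code :: "nat \<Rightarrow> (nat \<Rightarrow> 'a set) \<Rightarrow> 'a \<Rightarrow> real" where
  "box_code n Z x = (\<Sum>i<n. real (2^i) * indicator (Z i) x)"

lemma box_code_in_bit_region_iff:
  assumes "i < n"
  shows "box_code n Z x \<in> bit_region i \<longleftrightarrow> x \<in> Z i"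
proof -
  let ?k = "horner_sum of_bool 2 (map (\<lambda>j. x \<in> Z j) [0..<n]) :: nat"
  have "box_code n Z x = real ?k"
    unfolding box_code_def horner_sum_eq_sum
    by (auto simp: indicator_def atLeast0LessThan intro!: sum.cong)
  then show ?thesis
    using assms by (simp add: real_in_bit_region_iff bit_horner_sum_bit_iff)
qed

lemma box_code_in_L_functions:
  assumes "\<And>i. i < n \<Longrightarrow> Z i \<in> zero_sets X"
  shows "restrict (box_code n Z) (topspace X) \<in> L_functions X"
  unfolding L_functions_def
  by (rule CollectI, rule exI[of _ n], rule exI[of _ "\<lambda>i. 2^i"], rule exI[of _ Z])
    (use assms in \<open>auto simp: box_code_def\<close>)

text \<open>The code of a box is a test function: the open set \<open>W x\<close> defined from bit regions at the
  coordinates of \<open>x\<close> contains it if and only if \<open>x\<close> lies in the box. Thinning out the family of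
  all \<open>W x\<close> without changing its union therefore leaves a set of \<open>x\<close> that meets the same boxes.\<close>

lemma hd_power_baire_le:
  fixes X :: "'a topology" and \<tau> :: "'c rel"
  assumes L: "L_functions X \<subseteq> E"
    and \<tau>: "Card_order \<tau>" "natLeq \<le>o \<tau>"
    and hl: "hl (pointwise_topology X E) \<le>o \<tau>"
  shows "hd_card (power_topology (baire_topology X) n) \<le>o \<tau>"
  unfolding hd_card_le_iff[OF \<tau>]
proof (intro allI impI)
  let ?P = "power_topology (baire_topology X) n"
  fix A assume A: "A \<subseteq> topspace ?P"
  have coord: "x i \<in> topspace X" if "x \<in> A" "i < n" for x i
    using that A unfolding power_topology_def by (auto simp: PiE_iff)
  define W where "W x = {f \<in> topspace (pointwise_topology X E). \<forall>i<n. f (x i) \<in> bit_region i}"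
    for x :: "nat \<Rightarrow> 'a"
  have "openin (pointwise_topology X E) (W x)" if "x \<in> A" for x
  proof -
    have c: "continuous_map (pointwise_topology X E) euclideanreal (\<lambda>f. f (x i))" if "i < n" for i
      unfolding pointwise_topology_def
      by (intro continuous_map_from_subtopology continuous_map_product_projection coord)
        (use that \<open>x \<in> A\<close> in auto)
    have "openin (pointwise_topology X E)
        (topspace (pointwise_topology X E) \<inter>
          (\<Inter>i<n. {f \<in> topspace (pointwise_topology X E). f (x i) \<in> bit_region i}))"
      by (intro openin_Int_Inter finite_imageI)
        (auto intro!: openin_continuous_map_preimage[OF c] simp: open_bit_region)
    moreover have "\<dots> = W x" unfolding W_def by auto
    ultimately show ?thesis by simp
  qed
  then have "\<forall>U\<in>W ` A. openin (pointwise_topology X E) U" by blast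
  then obtain \<V> where \<V>: "\<V> \<subseteq> W ` A" "|\<V>| \<le>o \<tau>" "\<Union>\<V> = \<Union>(W ` A)"
    using hl[unfolded hl_le_iff[OF \<tau>], rule_format, of "W ` A"] by metis
  \<comment> \<open>injectivity of \<open>W\<close> on \<open>D\<close> transfers the bound on \<open>\<V>\<close> to \<open>D\<close>\<close>
  then obtain D where D: "D \<subseteq> A" "inj_on W D" "\<V> = W ` D"
    unfolding subset_image_inj by blast
  have "|D| \<le>o \<tau>"
    using ordLeq_transitive[OF card_of_ordLeqI[of W D \<V>] \<V>(2)] D(2,3) by blast
  moreover have "A \<subseteq> ?P closure_of D"
  proof
    fix x assume x: "x \<in> A"
    have "\<exists>y. y \<in> D \<and> y \<in> U" if U: "x \<in> U" "openin ?P U" for U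
    proof -
      obtain Z where Z: "\<And>i. i < n \<Longrightarrow> Z i \<in> zero_sets X"
        "x \<in> PiE {..<n} Z" "PiE {..<n} Z \<subseteq> U"
        by (rule zero_box_neighbourhood[OF U(2,1)]) blast
      let ?f = "restrict (box_code n Z) (topspace X)"
      have f: "?f \<in> topspace (pointwise_topology X E)"
        unfolding pointwise_topology_def using box_code_in_L_functions[OF Z(1)] L
        by (auto simp: PiE_iff)
      have W_iff: "?f \<in> W y \<longleftrightarrow> y \<in> PiE {..<n} Z" if y: "y \<in> A" for y
      proof -
        have "y \<in> extensional {..<n}"
          using y A unfolding power_topology_def by (auto simp: PiE_iff)
        then show ?thesis
          using f coord[OF y] unfolding W_def
          by (auto simp: PiE_iff box_code_in_bit_region_iff)
      qed
      have "?f \<in> \<Union>\<V>" unfolding \<V>(3) using W_iff[OF x] Z(2) x by blast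
      then obtain y where "y \<in> D" "?f \<in> W y" unfolding D(3) by blast
      then show ?thesis using W_iff D(1) Z(3) by blast
    qed
    then show "x \<in> ?P closure_of D" unfolding in_closure_of using A x by blast
  qed
  ultimately show "\<exists>D\<subseteq>A. |D| \<le>o \<tau> \<and> A \<subseteq> ?P closure_of D" using D(1) by blast
qed

theorem theorem4p2:
  fixes X :: "'a topology" and E :: "('a \<Rightarrow> real) set"
  assumes "tychonoff_space X"
    and "L_functions X \<subseteq> E"
    and "E \<subseteq> real_continuous_functions (baire_topology X)"
  shows "hl (pointwise_topology X E) =o hd_star (baire_topology X)"
  unfolding ordIso_iff_ordLeq
proof
  let ?Y = "baire_topology X"
  have "hd_star ?Y \<le>o hd_star ?Y" by (rule ordLeq_refl[OF hd_star_infinite(1)])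
  then have "hd_card (power_topology ?Y n) \<le>o hd_star ?Y" if "1 \<le> n" for n
    using that hd_star_le_iff[OF hd_star_infinite(1)] by blast
  then show "hl (pointwise_topology X E) \<le>o hd_star ?Y"
    by (intro hl_pointwise_topology_le[OF _ assms(3)] hd_star_infinite) auto
  have "hl (pointwise_topology X E) \<le>o hl (pointwise_topology X E)"
    by (rule ordLeq_refl[OF hl_infinite(1)])
  then show "hd_star ?Y \<le>o hl (pointwise_topology X E)"
    unfolding hd_star_le_iff[OF hl_infinite(1)]
    using hd_power_baire_le[OF assms(2) hl_infinite] by blast
qed

end
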